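(* Let $(X,\mu)$ and $(Y,\nu)$ be strong generalized topological spaces and let $f:(X,\mu)\to(Y,\nu)$ be a surjective mapping. Then the following conditions are equivalent. (1) $f$ is a $g$-closed mapping. (2) For every $A\subseteq X$, $C(f(A))\subseteq f(C(A))$. (3) For every $B\subseteq Y$ and every $U\in\mu$ such that $f^{-1}(B)\subseteq U$, there is $V\in\nu$ such that $B\subseteq V$ and $f^{-1}(V)\subseteq U$. (4) For every $y\in Y$ and every $U\in\mu$ such that $f^{-1}(y)\subseteq U$, there is $V\in\nu$ such that $y\in V$ and $f^{-1}(V)\subseteq U$.
   Context: A generalized topological space is a pair $(X,\mu)$ where $X$ is a set and $\mu$ is a family of subsets of $X$ such that $\emptyset\in\mu$ and any union of elements of $\mu$ belongs to $\mu$ (intersections are not required to belong to $\mu$). It is strong if $X\in\mu$. A set $B\subseteq X$ is $\mu$-open if $B\in\mu$, and $\mu$-closed if $X\setminus B\in\mu$. The closure $C(B)$ is the intersection of all $\mu$-closed sets containing $B$; closures are taken in the space of which the set is a subset ($(X,\mu)$ or $(Y,\nu)$). No continuity of $f$ is assumed. The mapping $f$ is $g$-closed if $f(F)$ is a $\nu$-closed subset of $Y$ for each $\mu$-closed subset $F$ of $X$. Here $f^{-1}(y)$ denotes the fibre $f^{-1}(\{y\})$. *)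

theory Defs
  imports Main
begin

definition gen_topology :: "'a set \<Rightarrow> 'a set set \<Rightarrow> bool" where
  "gen_topology X \<mu> \<longleftrightarrow> \<mu> \<subseteq> Pow X \<and> {} \<in> \<mu> \<and> (\<forall>\<S>. \<S> \<subseteq> \<mu> \<longrightarrow> \<Union>\<S> \<in> \<mu>)"

definition strong_gen_topology :: "'a set \<Rightarrow> 'a set set \<Rightarrow> bool" where
  "strong_gen_topology X \<mu> \<longleftrightarrow> gen_topology X \<mu> \<and> X \<in> \<mu>"

definition gen_closed :: "'a set \<Rightarrow> 'a set set \<Rightarrow> 'a set \<Rightarrow> bool" where
  "gen_closed X \<mu> F \<longleftrightarrow> F \<subseteq> X \<and> X - F \<in> \<mu>"

text \<open>Meant for subsets of \<open>X\<close>. The intersected family is then nonempty, since \<open>X\<close> itself is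
  closed (\<open>{} \<in> \<mu>\<close>), so the closure stays inside \<open>X\<close>.\<close>

definition gen_closure :: "'a set \<Rightarrow> 'a set set \<Rightarrow> 'a set \<Rightarrow> 'a set" where
  "gen_closure X \<mu> B = \<Inter>{F. gen_closed X \<mu> F \<and> B \<subseteq> F}"

definition g_closed_map ::
    "'a set \<Rightarrow> 'a set set \<Rightarrow> 'b set \<Rightarrow> 'b set set \<Rightarrow> ('a \<Rightarrow> 'b) \<Rightarrow> bool" where
  "g_closed_map X \<mu> Y \<nu> f \<longleftrightarrow> (\<forall>F. gen_closed X \<mu> F \<longrightarrow> gen_closed Y \<nu> (f ` F))"

text \<open>Maps are total HOL functions of which only the values on the carrier matter, so preimages are
  cut down to the carrier.\<close>

definition preimage_on :: "'a set \<Rightarrow> ('a \<Rightarrow> 'b) \<Rightarrow> 'b set \<Rightarrow> 'a set" where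
  "preimage_on X f B = f -` B \<inter> X"

end

theory Submission
  imports Defs
begin

text \<open>
  Everything rests on a complementation principle: the preimage of \<open>V\<close> lies in \<open>U\<close> exactly when
  \<open>V\<close> misses \<open>f ` (X - U)\<close> (lemma \<open>preimage_on_subset_iff\<close>). Consequently the largest subset of \<open>Y\<close>
  whose preimage lies in \<open>U\<close> is \<open>Y - f ` (X - U)\<close>, and \<open>f\<close> is g-closed exactly when this set is
  \<open>\<nu>\<close>-open for every \<open>\<mu>\<close>-open \<open>U\<close>.

  If it is open, it serves as the witness \<open>V\<close> for every \<open>B\<close> whose preimage lies in \<open>U\<close>
  (lemma \<open>g_closed_map_open_saturation\<close>), and the condition on points is the case of singletons
  \<open>B\<close>. Conversely, the condition on points provides around each point of \<open>Y - f ` (X - U)\<close> an open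
  set contained in it, so that it is a union of open sets (lemma \<open>g_closed_map_if_fibrewise\<close>).

  For the condition on closures, g-closed maps send the closed set \<open>gen_closure X \<mu> A\<close> to a closed
  set containing \<open>f ` A\<close>, hence containing its closure; conversely, for closed \<open>A\<close> the inclusion
  says that \<open>f ` A\<close> equals its own closure. Both directions rest on the closure being the least
  closed superset, which holds because the open sets are closed under unions.
\<close>

lemma gen_topology_subsetD: "gen_topology X \<mu> \<Longrightarrow> U \<in> \<mu> \<Longrightarrow> U \<subseteq> X"
  by (auto simp: gen_topology_def)

lemma gen_topology_Union: "gen_topology X \<mu> \<Longrightarrow> \<S> \<subseteq> \<mu> \<Longrightarrow> \<Union>\<S> \<in> \<mu>"
  by (auto simp: gen_topology_def)

lemma gen_closed_diff:
  assumes "gen_topology X \<mu>" "U \<in> \<mu>"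
  shows "gen_closed X \<mu> (X - U)"
  using assms gen_topology_subsetD[OF assms]
  by (simp add: gen_closed_def double_diff)

lemma gen_closure_superset: "A \<subseteq> gen_closure X \<mu> A"
  by (auto simp: gen_closure_def)

lemma gen_closure_minimal: "gen_closed X \<mu> F \<Longrightarrow> A \<subseteq> F \<Longrightarrow> gen_closure X \<mu> A \<subseteq> F"
  by (auto simp: gen_closure_def)

text \<open>
  The complement of the closure is the union of the complements of the closed sets that are
  intersected. The restriction to \<open>A \<subseteq> X\<close> makes \<open>X\<close> one of them; without it the closure would be
  an empty intersection, hence not contained in \<open>X\<close> in general.
\<close>

lemma gen_closed_gen_closure:
  assumes "gen_topology X \<mu>" "A \<subseteq> X"
  shows "gen_closed X \<mu> (gen_closure X \<mu> A)"
proof -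
  have "gen_closed X \<mu> X"
    using assms(1) by (simp add: gen_closed_def gen_topology_def)
  then have "gen_closure X \<mu> A \<subseteq> X"
    using assms(2) by (rule gen_closure_minimal)
  moreover have "X - gen_closure X \<mu> A = \<Union>((\<lambda>F. X - F) ` {F. gen_closed X \<mu> F \<and> A \<subseteq> F})"
    by (auto simp: gen_closure_def)
  moreover have "\<Union>((\<lambda>F. X - F) ` {F. gen_closed X \<mu> F \<and> A \<subseteq> F}) \<in> \<mu>"
    using assms(1) by (rule gen_topology_Union) (auto simp: gen_closed_def)
  ultimately show ?thesis
    by (simp add: gen_closed_def)
qed

lemma preimage_on_subset_iff: "preimage_on X f V \<subseteq> U \<longleftrightarrow> V \<inter> f ` (X - U) = {}"
  by (auto simp: preimage_on_def)

lemma g_closed_map_iff_closure_image: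
  assumes "gen_topology X \<mu>" "gen_topology Y \<nu>" "f ` X \<subseteq> Y"
  shows "g_closed_map X \<mu> Y \<nu> f \<longleftrightarrow>
    (\<forall>A. A \<subseteq> X \<longrightarrow> gen_closure Y \<nu> (f ` A) \<subseteq> f ` gen_closure X \<mu> A)"
    (is "_ \<longleftrightarrow> ?closure_image")
proof
  assume closed: "g_closed_map X \<mu> Y \<nu> f"
  show ?closure_image
  proof (intro allI impI)
    fix A assume "A \<subseteq> X"
    then have "gen_closed Y \<nu> (f ` gen_closure X \<mu> A)"
      using closed assms(1) by (simp add: g_closed_map_def gen_closed_gen_closure)
    then show "gen_closure Y \<nu> (f ` A) \<subseteq> f ` gen_closure X \<mu> A"
      by (rule gen_closure_minimal) (intro image_mono gen_closure_superset)
  qed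
next
  assume closure_image: ?closure_image
  show "g_closed_map X \<mu> Y \<nu> f"
    unfolding g_closed_map_def
  proof (intro allI impI)
    fix F assume F: "gen_closed X \<mu> F"
    then have "F \<subseteq> X"
      by (simp add: gen_closed_def)
    then have "gen_closure Y \<nu> (f ` F) \<subseteq> f ` gen_closure X \<mu> F"
      using closure_image by blast
    also have "\<dots> \<subseteq> f ` F"
      using F by (intro image_mono gen_closure_minimal) auto
    finally have "gen_closure Y \<nu> (f ` F) = f ` F"
      by (intro subset_antisym gen_closure_superset)
    then show "gen_closed Y \<nu> (f ` F)"
      using gen_closed_gen_closure[OF assms(2), of "f ` F"] \<open>F \<subseteq> X\<close> assms(3) by auto
  qed
qed

lemma g_closed_map_open_saturation:
  assumes "gen_topology X \<mu>" "g_closed_map X \<mu> Y \<nu> f"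
    and "B \<subseteq> Y" "U \<in> \<mu>" "preimage_on X f B \<subseteq> U"
  shows "\<exists>V\<in>\<nu>. B \<subseteq> V \<and> preimage_on X f V \<subseteq> U"
proof
  show "Y - f ` (X - U) \<in> \<nu>"
    using assms(2) gen_closed_diff[OF assms(1,4)] by (simp add: g_closed_map_def gen_closed_def)
  show "B \<subseteq> Y - f ` (X - U) \<and> preimage_on X f (Y - f ` (X - U)) \<subseteq> U"
    using assms(3,5) unfolding preimage_on_subset_iff by blast
qed

text \<open>
  Here the witnesses for the single fibres are glued: those contained in the complement of
  \<open>f ` F\<close> already cover it.
\<close>

lemma g_closed_map_if_fibrewise:
  assumes "gen_topology Y \<nu>" "f ` X \<subseteq> Y"
    and fibre: "\<And>y U. y \<in> Y \<Longrightarrow> U \<in> \<mu> \<Longrightarrow> preimage_on X f {y} \<subseteq> U \<Longrightarrow>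
      \<exists>V\<in>\<nu>. y \<in> V \<and> preimage_on X f V \<subseteq> U"
  shows "g_closed_map X \<mu> Y \<nu> f"
  unfolding g_closed_map_def
proof (intro allI impI)
  fix F assume "gen_closed X \<mu> F"
  then have F: "F \<subseteq> X" "X - F \<in> \<mu>"
    by (auto simp: gen_closed_def)
  have misses: "preimage_on X f V \<subseteq> X - F \<longleftrightarrow> V \<inter> f ` F = {}" for V
    using F(1) by (simp add: preimage_on_subset_iff double_diff)
  have "Y - f ` F = \<Union>{V \<in> \<nu>. V \<inter> f ` F = {}}"
  proof
    show "Y - f ` F \<subseteq> \<Union>{V \<in> \<nu>. V \<inter> f ` F = {}}"
    proof
      fix y assume "y \<in> Y - f ` F"
      then show "y \<in> \<Union>{V \<in> \<nu>. V \<inter> f ` F = {}}"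
        using fibre[of y "X - F"] F(2) unfolding misses by blast
    qed
    show "\<Union>{V \<in> \<nu>. V \<inter> f ` F = {}} \<subseteq> Y - f ` F"
      using gen_topology_subsetD[OF assms(1)] by blast
  qed
  moreover have "\<Union>{V \<in> \<nu>. V \<inter> f ` F = {}} \<in> \<nu>"
    using assms(1) by (rule gen_topology_Union) blast
  ultimately show "gen_closed Y \<nu> (f ` F)"
    using image_mono[OF F(1), of f] assms(2) by (simp add: gen_closed_def)
qed

theorem theorem2:
  fixes X :: "'a set" and \<mu> :: "'a set set"
    and Y :: "'b set" and \<nu> :: "'b set set"
    and f :: "'a \<Rightarrow> 'b"
  assumes "strong_gen_topology X \<mu>"
    and "strong_gen_topology Y \<nu>"
    and "f ` X = Y"
  shows
    "(g_closed_map X \<mu> Y \<nu> f \<longleftrightarrow>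
        (\<forall>A. A \<subseteq> X \<longrightarrow> gen_closure Y \<nu> (f ` A) \<subseteq> f ` gen_closure X \<mu> A))
     \<and> (g_closed_map X \<mu> Y \<nu> f \<longleftrightarrow>
        (\<forall>B U. B \<subseteq> Y \<longrightarrow> U \<in> \<mu> \<longrightarrow> preimage_on X f B \<subseteq> U \<longrightarrow>
          (\<exists>V\<in>\<nu>. B \<subseteq> V \<and> preimage_on X f V \<subseteq> U)))
     \<and> (g_closed_map X \<mu> Y \<nu> f \<longleftrightarrow>
        (\<forall>y\<in>Y. \<forall>U\<in>\<mu>. preimage_on X f {y} \<subseteq> U \<longrightarrow>
          (\<exists>V\<in>\<nu>. y \<in> V \<and> preimage_on X f V \<subseteq> U)))"
proof -
  have X: "gen_topology X \<mu>" and Y: "gen_topology Y \<nu>"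
    using assms(1,2) by (auto simp: strong_gen_topology_def)
  have f: "f ` X \<subseteq> Y"
    using assms(3) by simp
  let ?sets = "\<forall>B U. B \<subseteq> Y \<longrightarrow> U \<in> \<mu> \<longrightarrow> preimage_on X f B \<subseteq> U \<longrightarrow>
    (\<exists>V\<in>\<nu>. B \<subseteq> V \<and> preimage_on X f V \<subseteq> U)"
  let ?points = "\<forall>y\<in>Y. \<forall>U\<in>\<mu>. preimage_on X f {y} \<subseteq> U \<longrightarrow>
    (\<exists>V\<in>\<nu>. y \<in> V \<and> preimage_on X f V \<subseteq> U)"
  have "?sets" if "g_closed_map X \<mu> Y \<nu> f"
    using g_closed_map_open_saturation[OF X that] by blast
  moreover have "?points" if sets: "?sets"
  proof (intro ballI impI)
    fix y U assume "y \<in> Y" "U \<in> \<mu>" "preimage_on X f {y} \<subseteq> U"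
    then show "\<exists>V\<in>\<nu>. y \<in> V \<and> preimage_on X f V \<subseteq> U"
      using sets[rule_format, of "{y}" U] by simp
  qed
  moreover have "g_closed_map X \<mu> Y \<nu> f" if "?points"
    using Y f by (rule g_closed_map_if_fibrewise) (use that in blast)
  ultimately show ?thesis
    using g_closed_map_iff_closure_image[OF X Y f] by argo
qed

end
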